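(* Let $\{\Omega_j\}_{j=1}^\infty$ be an increasing sequence (that is, $\Omega_j\subset\Omega_{j+1}$ for all $j$) of pseudoconvex Reinhardt domains in $\mathbb{C}^n$, and let $\Omega_\infty:=\bigcup_{j=1}^\infty\Omega_j$. Then $\Omega_\infty$ is a pseudoconvex Reinhardt domain and, for each $1\le p<\infty$, the $p$-monomial basis kernels satisfy \[ K_p^{\Omega_j}(z,w)\longrightarrow K_p^{\Omega_\infty}(z,w)\qquad (j\to\infty) \] uniformly on compact subsets of $\Omega_\infty\times\Omega_\infty$ (each compact subset of $\Omega_\infty\times\Omega_\infty$ being contained in $\Omega_j\times\Omega_j$ for all large $j$).
   Context: A domain is a non-empty connected open set. A domain $\Omega\subset\mathbb{C}^n$ is Reinhardt if $(z_1,\dots,z_n)\in\Omega$ implies $(e^{i\tau_1}z_1,\dots,e^{i\tau_n}z_n)\in\Omega$ for all $(\tau_1,\dots,\tau_n)\in\mathbb{R}^n$. For $1\le p<\infty$, $A^p(\Omega)$ denotes the space of holomorphic functions $f$ on $\Omega$ with $\|f\|_{p,\Omega}^p:=\int_\Omega|f|^p\,dV<\infty$, where $dV$ is Lebesgue measure. For $\alpha=(\alpha_1,\dots,\alpha_n)\in\mathbb{Z}^n$, $e_\alpha(z):=z_1^{\alpha_1}\cdots z_n^{\alpha_n}$ (a Laurent monomial if some exponents are negative). The $p$-allowable index set is $S_p(\Omega):=\{\alpha\in\mathbb{Z}^n: e_\alpha\in A^p(\Omega)\}$. For $z,w\in\Omega$ and $\alpha\in\mathbb{Z}^n$ put \[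 E_{\alpha,p}^{\Omega}(z,w):=\frac{e_\alpha(z)\,\overline{e_\alpha(w)}\,|e_\alpha(w)|^{p-2}}{\|e_\alpha\|_{p,\Omega}^p}\ \text{ if }\alpha\in S_p(\Omega),\qquad E_{\alpha,p}^{\Omega}(z,w):=0\ \text{ if }\alpha\notin S_p(\Omega), \] where $\overline{e_\alpha(w)}|e_\alpha(w)|^{p-2}$ is read as $0$ when $e_\alpha(w)=0$. The $p$-monomial basis kernel is $K_p^{\Omega}(z,w):=\sum_{\alpha\in\mathbb{Z}^n}E_{\alpha,p}^{\Omega}(z,w)$; for pseudoconvex Reinhardt $\Omega$ it is known that this series converges uniformly on compact subsets of $\Omega\times\Omega$. *)

theory Defs
  imports "HOL-Analysis.Analysis"
begin

definition holomorphic_cn :: "(complex ^ 'n \<Rightarrow> complex) \<Rightarrow> (complex ^ 'n) set \<Rightarrow> bool" where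
  "holomorphic_cn f \<Omega> \<longleftrightarrow>
     (\<forall>z\<in>\<Omega>. \<exists>f'. (f has_derivative f') (at z) \<and> (\<forall>c v. f' (c *s v) = c * f' v))"

definition usc_on :: "('a::topological_space) set \<Rightarrow> ('a \<Rightarrow> real) \<Rightarrow> bool" where
  "usc_on S u \<longleftrightarrow> (\<forall>x\<in>S. \<forall>c > u x. \<forall>\<^sub>F y in at x within S. u y < c)"

(* Plurisubharmonicity for functions that do not take the value -\<infinity>: upper semicontinuity and
   the sub-mean value inequality on every closed complex disc in \<Omega>. Integrability loses no
   generality, since a circle mean of such a function is bounded below by its finite value at
   the centre; it is required because a non-integrable function has integral 0 here. *)
definition plurisubharmonic_on :: "(complex ^ 'n) set \<Rightarrow> (complex ^ 'n \<Rightarrow> real) \<Rightarrow> bool" where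
  "plurisubharmonic_on \<Omega> u \<longleftrightarrow>
     usc_on \<Omega> u \<and>
     (\<forall>z w. (\<forall>\<zeta>. norm \<zeta> \<le> 1 \<longrightarrow> z + \<zeta> *s w \<in> \<Omega>) \<longrightarrow>
        set_integrable lborel {0..2 * pi} (\<lambda>\<theta>. u (z + cis \<theta> *s w)) \<and>
        u z \<le> (1 / (2 * pi)) * (LBINT \<theta>:{0..2 * pi}. u (z + cis \<theta> *s w)))"

(* Pseudoconvexity in the standard sense that -log (distance to the boundary) is
   plurisubharmonic. The whole space, where that distance is infinite, is pseudoconvex by
   convention. For z in an open \<Omega>, the distance to the complement equals that to the boundary. *)
definition pseudoconvex :: "(complex ^ 'n) set \<Rightarrow> bool" where
  "pseudoconvex \<Omega> \<longleftrightarrow>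
     open \<Omega> \<and> (\<Omega> = UNIV \<or> plurisubharmonic_on \<Omega> (\<lambda>z. - ln (infdist z (- \<Omega>))))"

definition reinhardt_domain :: "(complex ^ 'n) set \<Rightarrow> bool" where
  "reinhardt_domain \<Omega> \<longleftrightarrow>
     \<Omega> \<noteq> {} \<and> connected \<Omega> \<and> open \<Omega> \<and>
     (\<forall>z\<in>\<Omega>. \<forall>\<tau> :: real ^ 'n. (\<chi> i. cis (\<tau> $ i) * z $ i) \<in> \<Omega>)"

definition Lp_norm_pow :: "real \<Rightarrow> (complex ^ 'n) set \<Rightarrow> (complex ^ 'n \<Rightarrow> complex) \<Rightarrow> real" where
  "Lp_norm_pow p \<Omega> f = (LINT z:\<Omega>|lborel. norm (f z) powr p)"

definition bergman_space :: "real \<Rightarrow> (complex ^ 'n) set \<Rightarrow> (complex ^ 'n \<Rightarrow> complex) set" where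
  "bergman_space p \<Omega> =
     {f. holomorphic_cn f \<Omega> \<and> set_integrable lborel \<Omega> (\<lambda>z. norm (f z) powr p)}"

(* 0 powi k = 0 for k < 0, so a Laurent monomial is also given a value on the coordinate
   hyperplanes where it is undefined. It is not holomorphic at those points, hence not in
   the Bergman space of a domain meeting such a hyperplane. *)
definition laurent_monomial :: "int ^ 'n \<Rightarrow> complex ^ 'n \<Rightarrow> complex" where
  "laurent_monomial \<alpha> z = (\<Prod>i\<in>UNIV. (z $ i) powi (\<alpha> $ i))"

definition allowable :: "real \<Rightarrow> (complex ^ 'n) set \<Rightarrow> (int ^ 'n) set" where
  "allowable p \<Omega> = {\<alpha>. laurent_monomial \<alpha> \<in> bergman_space p \<Omega>}"

definition monomial_term ::
  "real \<Rightarrow> (complex ^ 'n) set \<Rightarrow> int ^ 'n \<Rightarrow> complex ^ 'n \<Rightarrow> complex ^ 'n \<Rightarrow> complex" where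
  "monomial_term p \<Omega> \<alpha> z w =
     (if \<alpha> \<in> allowable p \<Omega>
      then laurent_monomial \<alpha> z * cnj (laurent_monomial \<alpha> w)
             * of_real (norm (laurent_monomial \<alpha> w) powr (p - 2))
             / of_real (Lp_norm_pow p \<Omega> (laurent_monomial \<alpha>))
      else 0)"

definition monomial_basis_kernel ::
  "real \<Rightarrow> (complex ^ 'n) set \<Rightarrow> complex ^ 'n \<Rightarrow> complex ^ 'n \<Rightarrow> complex" where
  "monomial_basis_kernel p \<Omega> z w = (\<Sum>\<^sub>\<infinity>\<alpha>\<in>UNIV. monomial_term p \<Omega> \<alpha> z w)"

end

theory Submission
  imports Defs
begin

text \<open>
  Pseudoconvexity passes to the union because \<open>- log dist(z, \<partial>\<Omega>\<^sub>j)\<close> decreases to its counterpart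
  for the union. For the kernels, each \<open>\<parallel>e\<^sub>\<alpha>\<parallel>\<close> increases along the exhaustion to its value on the
  union (possibly infinite), so the terms of the series converge. On a compact subset of
  \<open>\<Omega>\<^sub>J \<times> \<Omega>\<^sub>J\<close> the terms for all \<open>j \<ge> J\<close> share a summable majorant: every point of an open set has
  a neighbourhood on which \<open>|e\<^sub>\<alpha>|\<^sup>p / \<parallel>e\<^sub>\<alpha>\<parallel>\<^sup>p\<close> decays exponentially in \<open>\<alpha>\<close>, since \<open>|e\<^sub>\<alpha>|\<close> is exponentially
  larger on a nearby ball. Dominated convergence for series then gives uniform convergence.
\<close>

section \<open>Exhaustions by open sets and the geometry of the union\<close>

text \<open>A finite subcover has a largest index, and monotonicity makes the set with that index
  contain \<open>L\<close>. This serves closed balls, closed analytic discs and the projections of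
  \<open>K\<close>.\<close>

lemma compact_subset_incseq_open:
  fixes A :: "nat \<Rightarrow> 'a::topological_space set"
  assumes "compact L" "\<And>j. open (A j)" "incseq A" "L \<subseteq> (\<Union>j. A j)"
  shows "\<forall>\<^sub>F j in sequentially. L \<subseteq> A j"
proof -
  obtain C where C: "finite C" "L \<subseteq> (\<Union>j\<in>C. A j)"
    using assms(1,2,4) by (elim compactE_image[where C = UNIV]) auto
  have "L \<subseteq> A j" if "j \<ge> Max (insert 0 C)" for j
  proof -
    have "i \<le> j" if "i \<in> C" for i
      using \<open>finite C\<close> that \<open>j \<ge> _\<close> by auto
    then have "A i \<subseteq> A j" if "i \<in> C" for i
      using assms(3) that by (auto simp: incseq_def)
    with C show ?thesis by blast
  qed
  then show ?thesis
    unfolding eventually_sequentially by blast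
qed

text \<open>The distances never exceed the limit, by monotonicity. From below, a closed ball whose
  radius is smaller than the limiting distance is a compact subset of the union, so it lies in
  \<open>A j\<close> for large \<open>j\<close>. The hypothesis \<open>nU\<close> matters because
  \<open>infdist\<close> to the empty set is 0.\<close>

lemma tendsto_infdist_Compl_incseq:
  fixes A :: "nat \<Rightarrow> 'a::heine_borel set"
  assumes op: "\<And>j. open (A j)" and inc: "incseq A" and nU: "(\<Union>j. A j) \<noteq> UNIV"
  shows "(\<lambda>j. infdist z (- A j)) \<longlonglongrightarrow> infdist z (- (\<Union>j. A j))"
proof (rule order_tendstoI)
  fix a assume "infdist z (- (\<Union>j. A j)) < a"
  moreover have "infdist z (- A j) \<le> infdist z (- (\<Union>j. A j))" for j
    using nU by (intro infdist_mono) auto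
  ultimately show "\<forall>\<^sub>F j in sequentially. infdist z (- A j) < a"
    by (intro always_eventually) (meson le_less_trans)
next
  fix a assume "a < infdist z (- (\<Union>j. A j))"
  then obtain r where r: "a < r" "r < infdist z (- (\<Union>j. A j))"
    using dense by blast
  have "y \<in> (\<Union>j. A j)" if "dist z y \<le> r" for y
    using infdist_le[of y "- (\<Union>j. A j)" z] r that by force
  then have "cball z r \<subseteq> (\<Union>j. A j)"
    by (auto simp: subset_eq)
  then have "\<forall>\<^sub>F j in sequentially. cball z r \<subseteq> A j"
    using op inc by (intro compact_subset_incseq_open) auto
  then show "\<forall>\<^sub>F j in sequentially. a < infdist z (- A j)"
  proof eventually_elim
    case (elim j)
    have "- A j \<noteq> {}" using nU by auto
    moreover have "r \<le> dist z y" if "y \<in> - A j" for y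
      using elim that by (force simp: subset_eq)
    ultimately have "r \<le> infdist z (- A j)"
      by (subst infdist_notempty) (auto intro!: cINF_greatest)
    then show ?case using r by simp
  qed
qed

lemma usc_on_continuous_on:
  assumes "continuous_on S f"
  shows "usc_on S f"
  using assms unfolding usc_on_def continuous_on_def by (auto intro: order_tendstoD)

lemma continuous_on_neg_ln_infdist_Compl:
  assumes "open S" "S \<noteq> UNIV"
  shows "continuous_on S (\<lambda>z. - ln (infdist z (- S)))"
proof -
  have "infdist z (- S) > 0" if "z \<in> S" for z
    using assms that by (intro infdist_pos_not_in_closed) auto
  then have "infdist z (- S) \<noteq> 0" if "z \<in> S" for z
    using that by (metis less_irrefl)
  then show ?thesis
    by (intro continuous_intros ballI)
qed

text \<open>On a fixed closed disc the functions \<^term>\<open>\<lambda>z. - ln (infdist z (- A j))\<close> decrease to their limit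
  and are bounded between two continuous functions, so the mean value inequality survives the limit.\<close>

lemma pseudoconvex_incseq_Union:
  fixes A :: "nat \<Rightarrow> (complex ^ 'n) set"
  assumes pc: "\<And>j. pseudoconvex (A j)" and inc: "incseq A"
  shows "pseudoconvex (\<Union>j. A j)"
proof (cases "(\<Union>j. A j) = UNIV")
  case True
  then show ?thesis by (simp add: pseudoconvex_def)
next
  case False
  define U where "U = (\<Union>j. A j)"
  have op: "open (A j)" for j using pc by (simp add: pseudoconvex_def)
  then have opU: "open U" by (auto simp: U_def)
  have nU: "U \<noteq> UNIV" using False by (simp add: U_def)
  then have nA: "A j \<noteq> UNIV" for j by (auto simp: U_def)
  define v where "v j z = - ln (infdist z (- A j))" for j z
  define u where "u z = - ln (infdist z (- U))" for z
  have psh: "plurisubharmonic_on (A j) (v j)" for j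
    using pc[of j] nA[of j] by (simp add: pseudoconvex_def v_def[abs_def])
  have cont_v: "continuous_on (A j) (v j)" for j
    unfolding v_def by (intro continuous_on_neg_ln_infdist_Compl op nA)
  have cont_u: "continuous_on U u"
    unfolding u_def by (intro continuous_on_neg_ln_infdist_Compl opU nU)
  have pos: "infdist z (- U) > 0" if "z \<in> U" for z
    using opU nU that by (intro infdist_pos_not_in_closed) auto
  have posA: "infdist z (- A j) > 0" if "z \<in> A j" for z j
    using op nA[of j] that by (intro infdist_pos_not_in_closed) auto
  have lim: "(\<lambda>j. v j z) \<longlonglongrightarrow> u z" if "z \<in> U" for z
    unfolding v_def u_def U_def using pos[OF that] nU op inc
    by (intro tendsto_minus tendsto_ln tendsto_infdist_Compl_incseq) (auto simp: U_def)
  have AU: "A j \<subseteq> U" for j by (auto simp: U_def)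
  have ge: "u z \<le> v j z" if "z \<in> A j" for z j
  proof -
    have "infdist z (- A j) \<le> infdist z (- U)"
      using AU nU by (intro infdist_mono) auto
    then show ?thesis
      unfolding u_def v_def using posA[OF that] by simp
  qed
  have le: "v j z \<le> v i z" if "z \<in> A i" "i \<le> j" for z i j
  proof -
    have "A i \<subseteq> A j" using inc that by (auto simp: incseq_def)
    then have "infdist z (- A i) \<le> infdist z (- A j)"
      using nA by (intro infdist_mono) auto
    then show ?thesis
      unfolding v_def using posA[OF that(1)] by simp
  qed
  have "set_integrable lborel {0..2 * pi} (\<lambda>\<theta>. u (z + cis \<theta> *s w)) \<and>
        u z \<le> (1 / (2 * pi)) * (LBINT \<theta>:{0..2 * pi}. u (z + cis \<theta> *s w))"
    if disc: "\<forall>\<zeta>. norm \<zeta> \<le> 1 \<longrightarrow> z + \<zeta> *s w \<in> U" for z w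
  proof -
    have cl: "continuous_on S (\<lambda>\<zeta>. z + \<zeta> *s w)" for S
      by (intro continuous_intros continuous_on_vec_lambda) (simp add: vector_scalar_mult_def, intro continuous_intros)
    have cd: "compact ((\<lambda>\<zeta>. z + \<zeta> *s w) ` cball 0 1)"
      by (intro compact_continuous_image cl) auto
    have "\<forall>\<^sub>F j in sequentially. (\<lambda>\<zeta>. z + \<zeta> *s w) ` cball 0 1 \<subseteq> A j"
      using op inc disc by (intro compact_subset_incseq_open cd) (auto simp: U_def)
    then obtain N where N: "\<And>j \<zeta>. j \<ge> N \<Longrightarrow> norm \<zeta> \<le> 1 \<Longrightarrow> z + \<zeta> *s w \<in> A j"
      unfolding eventually_sequentially by (fastforce simp: subset_eq)
    define c where "c \<theta> = z + cis \<theta> *s w" for \<theta>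
    have c: "c \<theta> \<in> A j" if "j \<ge> N" for j \<theta>
      using N that by (simp add: c_def)
    have cc: "continuous_on S c" for S
      unfolding c_def by (rule continuous_on_compose2[OF cl[of UNIV]]) (auto intro!: continuous_intros)
    have iv: "set_integrable lborel {0..2 * pi} (\<lambda>\<theta>. v j (c \<theta>))" if "j \<ge> N" for j
      using c that by (intro borel_integrable_atLeastAtMost' continuous_on_compose2[OF cont_v cc]) auto
    have iu: "set_integrable lborel {0..2 * pi} (\<lambda>\<theta>. u (c \<theta>))"
      using c AU by (intro borel_integrable_atLeastAtMost' continuous_on_compose2[OF cont_u cc]) blast+
    \<comment> \<open>The shift by \<open>N\<close> keeps the whole circle inside every
      \<open>A (j + N)\<close>. There \<open>u\<close> lies below \<open>v (j + N)\<close>, which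
      lies below \<open>v N\<close>, so the sum of the absolute values of \<open>v N\<close> and
      \<open>u\<close> is an integrable majorant.\<close>
    have "(\<lambda>j. LBINT \<theta>:{0..2 * pi}. v (j + N) (c \<theta>)) \<longlonglongrightarrow> (LBINT \<theta>:{0..2 * pi}. u (c \<theta>))"
      unfolding set_lebesgue_integral_def
    proof (rule integral_dominated_convergence[where w = "\<lambda>\<theta>. indicator {0..2 * pi} \<theta> *\<^sub>R \<bar>v N (c \<theta>)\<bar> + indicator {0..2 * pi} \<theta> *\<^sub>R \<bar>u (c \<theta>)\<bar>"])
      show "integrable lborel (\<lambda>\<theta>. indicator {0..2 * pi} \<theta> *\<^sub>R \<bar>v N (c \<theta>)\<bar> + indicator {0..2 * pi} \<theta> *\<^sub>R \<bar>u (c \<theta>)\<bar>)"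
        using set_integrable_abs[OF iv[of N]] set_integrable_abs[OF iu]
        by (intro Bochner_Integration.integrable_add) (auto simp: set_integrable_def)
      show "AE \<theta> in lborel. norm (indicator {0..2 * pi} \<theta> *\<^sub>R v (i + N) (c \<theta>))
          \<le> indicator {0..2 * pi} \<theta> *\<^sub>R \<bar>v N (c \<theta>)\<bar> + indicator {0..2 * pi} \<theta> *\<^sub>R \<bar>u (c \<theta>)\<bar>" for i
      proof (rule AE_I2)
        fix \<theta>
        have "u (c \<theta>) \<le> v (i + N) (c \<theta>)" "v (i + N) (c \<theta>) \<le> v N (c \<theta>)"
          using c by (auto intro!: ge le)
        then have "\<bar>v (i + N) (c \<theta>)\<bar> \<le> \<bar>v N (c \<theta>)\<bar> + \<bar>u (c \<theta>)\<bar>" by linarith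
        then show "norm (indicator {0..2 * pi} \<theta> *\<^sub>R v (i + N) (c \<theta>))
          \<le> indicator {0..2 * pi} \<theta> *\<^sub>R \<bar>v N (c \<theta>)\<bar> + indicator {0..2 * pi} \<theta> *\<^sub>R \<bar>u (c \<theta>)\<bar>"
          by (auto simp: indicator_def)
      qed
      show "AE \<theta> in lborel. (\<lambda>i. indicator {0..2 * pi} \<theta> *\<^sub>R v (i + N) (c \<theta>))
              \<longlonglongrightarrow> indicator {0..2 * pi} \<theta> *\<^sub>R u (c \<theta>)"
        using c[of N] AU[of N] by (intro AE_I2 tendsto_intros LIMSEQ_ignore_initial_segment lim) blast
    qed (use iu iv in \<open>auto simp: set_integrable_def dest: borel_measurable_integrable\<close>)
    then have "(\<lambda>j. 1 / (2 * pi) * (LBINT \<theta>:{0..2 * pi}. v (j + N) (c \<theta>)))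
        \<longlonglongrightarrow> 1 / (2 * pi) * (LBINT \<theta>:{0..2 * pi}. u (c \<theta>))"
      by (intro tendsto_intros)
    moreover have "(\<lambda>j. v (j + N) z) \<longlonglongrightarrow> u z"
      using disc[rule_format, of 0] by (intro LIMSEQ_ignore_initial_segment lim) (simp add: vec_eq_iff)
    moreover have "v (j + N) z \<le> 1 / (2 * pi) * (LBINT \<theta>:{0..2 * pi}. v (j + N) (c \<theta>))" for j
      using psh[of "j + N"] N[of "j + N"] unfolding plurisubharmonic_on_def c_def by simp
    ultimately have "u z \<le> 1 / (2 * pi) * (LBINT \<theta>:{0..2 * pi}. u (c \<theta>))"
      by (intro LIMSEQ_le) auto
    with iu show ?thesis by (simp add: c_def)
  qed
  then have "plurisubharmonic_on U u"
    unfolding plurisubharmonic_on_def using cont_u by (auto intro: usc_on_continuous_on)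
  then show ?thesis
    using opU unfolding pseudoconvex_def U_def[symmetric] u_def by simp
qed

text \<open>A point of \<open>A 0\<close> belongs to every member of the sequence, so the union is
  one of connected sets with a common point. Rotation invariance is checked inside a single
  \<open>A j\<close>.\<close>

lemma reinhardt_domain_incseq_Union:
  fixes A :: "nat \<Rightarrow> (complex ^ 'n) set"
  assumes "\<And>j. reinhardt_domain (A j)" "incseq A"
  shows "reinhardt_domain (\<Union>j. A j)"
proof -
  have conn: "connected (A j)" and op: "open (A j)"
    and rot: "\<And>z \<tau>. z \<in> A j \<Longrightarrow> (\<chi> i. cis (\<tau> $ i) * z $ i) \<in> A j" for j
    using assms(1)[of j] by (simp_all add: reinhardt_domain_def)
  obtain a where a0: "a \<in> A 0" using assms(1)[of 0] by (auto simp: reinhardt_domain_def)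
  have a: "a \<in> A j" for j using incseqD[OF assms(2), of 0 j] a0 by auto
  have "connected (\<Union>j. A j)"
  proof (rule connected_Union)
    show "\<Inter> (range A) \<noteq> {}" using a by (metis INT_I empty_iff)
  qed (use conn in auto)
  moreover have "open (\<Union>j. A j)" using op by (intro open_UN) auto
  moreover have "(\<chi> i. cis (\<tau> $ i) * z $ i) \<in> (\<Union>j. A j)" if "z \<in> (\<Union>j. A j)" for z and \<tau> :: "real ^ 'n"
  proof -
    from that obtain j where "z \<in> A j" by blast
    then have "(\<chi> i. cis (\<tau> $ i) * z $ i) \<in> A j" by (rule rot)
    then show ?thesis by auto
  qed
  ultimately show ?thesis
    using a0 unfolding reinhardt_domain_def by (metis UN_I UNIV_I empty_iff)
qed

section \<open>Summation over multi-indices and dominated convergence of series\<close>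

text \<open>The integers split into the values n and -(n+1) for natural n. Both parts are geometric
  series, the second with an extra factor \<open>q\<close>.\<close>

lemma summable_on_power_abs:
  fixes q :: real
  assumes "0 < q" "q < 1"
  shows "(\<lambda>k::int. q ^ nat \<bar>k\<bar>) summable_on UNIV"
proof -
  have s: "(\<lambda>n. q ^ n) summable_on (UNIV :: nat set)"
    using assms by (intro norm_summable_imp_summable_on) (auto simp: summable_geometric)
  have "(\<lambda>k. q ^ nat \<bar>k\<bar>) summable_on range int"
    using s by (subst summable_on_reindex) (auto simp: o_def)
  moreover have "(\<lambda>k. q ^ nat \<bar>k\<bar>) summable_on range (\<lambda>n. - int (Suc n))"
    using summable_on_cmult_right[OF s, of q] by (subst summable_on_reindex) (auto simp: o_def inj_on_def nat_add_distrib)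
  moreover have "range int \<inter> range (\<lambda>n. - int (Suc n)) = {}" by auto
  ultimately have "(\<lambda>k. q ^ nat \<bar>k\<bar>) summable_on (range int \<union> range (\<lambda>n. - int (Suc n)))"
    by (intro summable_on_Un_disjoint)
  moreover have "range int \<union> range (\<lambda>n. - int (Suc n)) = UNIV"
  proof (intro equalityI subset_UNIV subsetI UnCI)
    fix k :: int
    assume "k \<notin> range (\<lambda>n. - int (Suc n))"
    then show "k \<in> range int" by (cases k) (simp_all del: of_nat_Suc)
  qed
  ultimately show ?thesis by simp
qed

text \<open>A product of absolutely convergent series converges absolutely over the product index
  set. The product rule used is the one for \<open>Infinite_Set_Sum\<close>, so summability is
  translated there and back; a bijection then replaces functions by vectors.\<close>

lemma summable_on_prod_vec:
  fixes h :: "'n::finite \<Rightarrow> 'a::countable \<Rightarrow> real"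
  assumes "\<And>i. h i summable_on UNIV" "\<And>i k. 0 \<le> h i k"
  shows "(\<lambda>\<alpha>::'a^'n. \<Prod>i\<in>UNIV. h i (\<alpha> $ i)) summable_on UNIV"
proof -
  have "Infinite_Sum.abs_summable_on (h i) UNIV" for i
    using assms by simp
  then have "Infinite_Set_Sum.abs_summable_on (\<lambda>g. \<Prod>i\<in>UNIV. h i (g i)) (PiE UNIV (\<lambda>_. UNIV))"
    by (intro abs_summable_on_prod_PiE) (simp_all only: abs_summable_equivalent finite countableI_type)
  then have "Infinite_Sum.abs_summable_on (\<lambda>g. \<Prod>i\<in>UNIV. h i (g i)) (UNIV :: ('n \<Rightarrow> 'a) set)"
    by (simp only: abs_summable_equivalent[symmetric] PiE_UNIV_domain Pi_UNIV)
  then have s: "(\<lambda>g. \<Prod>i\<in>UNIV. h i (g i)) summable_on (UNIV :: ('n \<Rightarrow> 'a) set)"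
    by (rule Infinite_Sum.abs_summable_summable)
  have "bij_betw (\<lambda>\<alpha>::'a^'n. ($) \<alpha>) UNIV UNIV"
    by (rule bij_betwI[where g = vec_lambda]) auto
  from summable_on_reindex_bij_betw[OF this, of "\<lambda>g. \<Prod>i\<in>UNIV. h i (g i)"] s show ?thesis by simp
qed

text \<open>An argument with three thirds of \<open>e\<close>: one finite set \<open>X\<close> of
  indices makes the tails of all the series with \<open>j \<ge> N\<close> and of the limit series
  small, and on \<open>X\<close> only finitely many uniform limits are added.\<close>

lemma uniform_limit_infsum_dominated:
  fixes f :: "nat \<Rightarrow> 'a \<Rightarrow> 'b \<Rightarrow> 'c::banach"
  assumes lim: "\<And>a. uniform_limit K (\<lambda>j. f j a) (F a) sequentially"
    and bound: "\<forall>\<^sub>F j in sequentially. \<forall>a. \<forall>x\<in>K. norm (f j a x) \<le> g a"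
    and summ: "g summable_on UNIV"
  shows "uniform_limit K (\<lambda>j x. \<Sum>\<^sub>\<infinity>a. f j a x) (\<lambda>x. \<Sum>\<^sub>\<infinity>a. F a x) sequentially"
proof (rule uniform_limitI)
  fix e :: real assume "e > 0"
  then have e: "e / 3 > 0" by simp
  obtain N where N: "\<And>j a x. j \<ge> N \<Longrightarrow> x \<in> K \<Longrightarrow> norm (f j a x) \<le> g a"
    using bound unfolding eventually_sequentially by blast
  have F: "norm (F a x) \<le> g a" if "x \<in> K" for a x
  proof (rule tendsto_upperbound)
    show "(\<lambda>j. norm (f j a x)) \<longlonglongrightarrow> norm (F a x)"
      using tendsto_uniform_limitI[OF lim that] by (rule tendsto_norm)
    show "\<forall>\<^sub>F j in sequentially. norm (f j a x) \<le> g a"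
      using bound that by (auto elim: eventually_mono)
  qed auto
  \<comment> \<open>The index \<open>j\<close> is made part of the point at which the M-test is
    applied; this is what makes \<open>X\<close> independent of \<open>j\<close>.\<close>
  have "uniform_limit ({N..} \<times> K) (\<lambda>X y. \<Sum>a\<in>X. f (fst y) a (snd y))
      (\<lambda>y. \<Sum>\<^sub>\<infinity>a. f (fst y) a (snd y)) (finite_subsets_at_top UNIV)"
    using N summ by (intro Weierstrass_m_test_general) auto
  then have 1: "\<forall>\<^sub>F X in finite_subsets_at_top UNIV. \<forall>y\<in>{N..} \<times> K.
      dist (\<Sum>a\<in>X. f (fst y) a (snd y)) (\<Sum>\<^sub>\<infinity>a. f (fst y) a (snd y)) < e / 3"
    using e by (rule uniform_limitD)
  have "uniform_limit K (\<lambda>X y. \<Sum>a\<in>X. F a y) (\<lambda>y. \<Sum>\<^sub>\<infinity>a. F a y) (finite_subsets_at_top UNIV)"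
    using F summ by (intro Weierstrass_m_test_general) auto
  then have 2: "\<forall>\<^sub>F X in finite_subsets_at_top UNIV. \<forall>y\<in>K. dist (\<Sum>a\<in>X. F a y) (\<Sum>\<^sub>\<infinity>a. F a y) < e / 3"
    using e by (rule uniform_limitD)
  obtain X where X: "\<And>j x. j \<ge> N \<Longrightarrow> x \<in> K \<Longrightarrow> dist (\<Sum>a\<in>X. f j a x) (\<Sum>\<^sub>\<infinity>a. f j a x) < e / 3"
     "\<And>x. x \<in> K \<Longrightarrow> dist (\<Sum>a\<in>X. F a x) (\<Sum>\<^sub>\<infinity>a. F a x) < e / 3"
    using eventually_happens'[OF _ eventually_conj[OF 1 2]] by force
  \<comment> \<open>Sums over infinite sets are 0, so the induction covers every
    \<open>X\<close>.\<close>
  have "uniform_limit K (\<lambda>j x. \<Sum>a\<in>X. f j a x) (\<lambda>x. \<Sum>a\<in>X. F a x) sequentially"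
    using lim by (induction X rule: infinite_finite_induct) (auto intro!: uniform_limit_intros)
  then have "\<forall>\<^sub>F j in sequentially. \<forall>x\<in>K. dist (\<Sum>a\<in>X. f j a x) (\<Sum>a\<in>X. F a x) < e / 3"
    using e by (rule uniform_limitD)
  then show "\<forall>\<^sub>F j in sequentially. \<forall>x\<in>K. dist (\<Sum>\<^sub>\<infinity>a. f j a x) (\<Sum>\<^sub>\<infinity>a. F a x) < e"
    using eventually_ge_at_top[of N]
  proof eventually_elim
    case (elim j)
    show ?case
    proof
      fix x assume x: "x \<in> K"
      have "dist (\<Sum>a\<in>X. f j a x) (\<Sum>a\<in>X. F a x) < e / 3" using elim x by blast
      with X(1)[OF elim(2) x] X(2)[OF x]
      show "dist (\<Sum>\<^sub>\<infinity>a. f j a x) (\<Sum>\<^sub>\<infinity>a. F a x) < e" by metric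
    qed
  qed
qed

section \<open>Exponential bounds for Laurent monomials against their norms\<close>

lemma norm_laurent_monomial:
  "norm (laurent_monomial \<alpha> z) = (\<Prod>i\<in>UNIV. norm (z $ i) powi (\<alpha> $ i))"
  by (simp add: laurent_monomial_def prod_norm[symmetric] norm_power_int)

lemma continuous_on_allowable:
  assumes "\<alpha> \<in> allowable p \<Omega>"
  shows "continuous_on \<Omega> (laurent_monomial \<alpha>)"
  using assms unfolding allowable_def bergman_space_def holomorphic_cn_def
  by (auto intro!: continuous_at_imp_continuous_on dest: has_derivative_continuous)

lemma open_ex_nonzero:
  fixes A :: "complex set"
  assumes "open A" "c \<in> A"
  shows "\<exists>b\<in>A. b \<noteq> 0"
proof (rule ccontr)
  assume "\<not> ?thesis"
  then have "A = {0}" using assms(2) by auto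
  then show False using assms(1) not_open_singleton[of "0::complex"] by simp
qed

text \<open>On a complex line in direction \<open>i\<close> the monomial is
  \<open>t powi (\<alpha> $ i)\<close> times a constant. With a negative exponent this is unbounded
  at \<open>t = 0\<close>, although allowability forces continuity there; the conventional value of
  \<open>powi\<close> at 0 cannot repair this.\<close>

lemma allowable_exponent_nonneg:
  fixes \<Omega> :: "(complex ^ 'n) set"
  assumes op: "open \<Omega>" and al: "\<alpha> \<in> allowable p \<Omega>" and a: "a \<in> \<Omega>" "a $ i = 0"
  shows "0 \<le> \<alpha> $ i"
proof (rule ccontr)
  assume neg: "\<not> 0 \<le> \<alpha> $ i"
  obtain A where A: "\<And>k. open (A k) \<and> a $ k \<in> A k" "\<And>y. (\<And>k. y $ k \<in> A k) \<Longrightarrow> y \<in> \<Omega>"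
    using op a(1) unfolding open_vec_def by metis
  \<comment> \<open>The other coordinates of \<open>a\<close> may vanish too; moving them off 0
    inside the box makes the constant \<open>c\<close> below nonzero.\<close>
  have "\<forall>k. \<exists>b. b \<in> A k \<and> b \<noteq> 0"
    using A(1) open_ex_nonzero by blast
  then obtain b where b: "\<And>k. b k \<in> A k" "\<And>k. b k \<noteq> 0" by metis
  define h where "h t = (\<chi> k. if k = i then t else b k)" for t
  have h0: "h 0 \<in> \<Omega>"
    using A(1)[of i] a(2) b(1) by (intro A(2)) (auto simp: h_def)
  define c where "c = (\<Prod>k\<in>UNIV - {i}. b k powi (\<alpha> $ k))"
  have c: "c \<noteq> 0" using b(2) by (auto simp: c_def power_int_eq_0_iff)
  have eh: "laurent_monomial \<alpha> (h t) = t powi (\<alpha> $ i) * c" for t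
    unfolding laurent_monomial_def c_def
    by (subst prod.remove[of UNIV i]) (auto simp: h_def intro!: prod.cong)
  have "isCont (laurent_monomial \<alpha>) (h 0)"
    using continuous_on_allowable[OF al] h0 op by (simp add: continuous_on_eq_continuous_at)
  moreover have "(h \<longlongrightarrow> h 0) (at 0)"
    unfolding h_def by (rule tendsto_vec_lambda) (auto intro: tendsto_ident_at)
  ultimately have "((\<lambda>t. laurent_monomial \<alpha> (h t)) \<longlongrightarrow> laurent_monomial \<alpha> (h 0)) (at 0)"
    by (rule isCont_tendsto_compose)
  \<comment> \<open>Multiplying by the opposite power of \<open>t\<close> gives two limits at 0:
    continuity yields 0, while the product equals \<open>c\<close> for all \<open>t\<close> other
    than 0.\<close>
  then have "((\<lambda>t. t ^ nat (- \<alpha> $ i) * laurent_monomial \<alpha> (h t)) \<longlongrightarrow>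
      0 ^ nat (- \<alpha> $ i) * laurent_monomial \<alpha> (h 0)) (at 0)"
    by (intro tendsto_intros)
  moreover have "(0::complex) ^ nat (- \<alpha> $ i) = 0"
    using neg by (intro zero_power) simp
  ultimately have "((\<lambda>t. t ^ nat (- \<alpha> $ i) * laurent_monomial \<alpha> (h t)) \<longlongrightarrow> 0) (at (0::complex))"
    by (simp only: mult_zero_left)
  moreover have "\<forall>\<^sub>F t in at (0::complex). t ^ nat (- \<alpha> $ i) * laurent_monomial \<alpha> (h t) = c"
    using eventually_neq_at_within[of 0 0 UNIV]
    by eventually_elim (use neg in \<open>simp add: eh power_int_def field_simps\<close>)
  then have "((\<lambda>t. t ^ nat (- \<alpha> $ i) * laurent_monomial \<alpha> (h t)) \<longlongrightarrow> c) (at (0::complex))"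
    by (rule tendsto_eventually)
  ultimately have "c = 0"
    by (intro tendsto_unique[of "at (0::complex)"]) auto
  with c show False by contradiction
qed

text \<open>A nonnegative power grows when \<open>\<zeta>\<close> has larger modulus than
  \<open>z\<close>, a negative one when it has smaller modulus. \<open>V True\<close> and
  \<open>V False\<close> are the corresponding regions of \<open>A\<close>, and the ratio
  \<open>l\<close> of the moduli does not depend on \<open>k\<close>, so the gain is exponential in
  the size of \<open>k\<close>.\<close>

lemma laurent_power_gain:
  fixes c :: complex
  assumes "open A" "c \<in> A"
  shows "\<exists>l U V. l > (1::real) \<and> open U \<and> c \<in> U \<and> (\<forall>s. open (V s) \<and> V s \<noteq> {} \<and> V s \<subseteq> A) \<and>
    (\<forall>k z \<zeta>. (0 \<le> k \<or> c \<noteq> 0) \<longrightarrow> z \<in> U \<longrightarrow> \<zeta> \<in> V (0 \<le> k) \<longrightarrow>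
       l ^ nat \<bar>k\<bar> * norm z powi k \<le> norm \<zeta> powi k)"
proof -
  obtain e where e: "e > 0" "ball c e \<subseteq> A"
    using assms openE by blast
  \<comment> \<open>Staying below \<open>e\<close> keeps points at distance \<open>d\<close> from
    \<open>c\<close> in \<open>A\<close>; the bound by half of \<open>norm c\<close> keeps the radii
    \<open>norm c - d\<close> and \<open>norm c - 2 * d / 3\<close> positive.\<close>
  define d where "d = (if c = 0 then e / 2 else min (e / 2) (norm c / 2))"
  have d: "0 < d" "d < e" "c \<noteq> 0 \<Longrightarrow> d \<le> norm c / 2"
    using e(1) by (auto simp: d_def min_def)
  define w where "w = (if c = 0 then 1 else sgn c)"
  have w: "norm w = 1" "c = of_real (norm c) * w"
    by (auto simp: w_def norm_sgn sgn_eq norm_divide)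
  \<comment> \<open>The points \<open>zp\<close> and \<open>zm\<close> lie on the ray through
    \<open>c\<close>, at modulus \<open>norm c\<close> plus or minus \<open>d\<close>. They witness
    that the regions with thresholds at \<open>2 * d / 3\<close> are nonempty.\<close>
  define zp where "zp = of_real (norm c + d) * w"
  define zm where "zm = of_real (norm c - d) * w"
  have zp: "zp \<in> A" "norm zp = norm c + d"
  proof -
    have "zp = c + of_real d * w" using w(2) by (simp add: zp_def algebra_simps)
    then have "dist c zp = d" using w(1) d by (simp add: dist_norm norm_mult)
    then show "zp \<in> A" using e d by auto
    show "norm zp = norm c + d" using w(1) d(1) by (simp add: zp_def norm_mult del: of_real_add)
  qed
  have zm: "zm \<in> A" "c \<noteq> 0 \<Longrightarrow> norm zm = norm c - d"
  proof -
    have "zm = c - of_real d * w" using w(2) by (simp add: zm_def algebra_simps)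
    then have "dist c zm = d" using w(1) d by (simp add: dist_norm norm_mult)
    then show "zm \<in> A" using e d by auto
    show "norm zm = norm c - d" if "c \<noteq> 0"
      using w(1) d(1) d(3)[OF that] by (simp add: zm_def norm_mult del: of_real_diff)
  qed
  \<comment> \<open>Each ratio compares the threshold at \<open>2 * d / 3\<close> with the extreme
    modulus in the ball of radius \<open>d / 3\<close> around \<open>c\<close>: \<open>l1\<close>
    for growing outwards, \<open>l2\<close> for shrinking inwards.\<close>
  define l1 where "l1 = (norm c + 2 * d / 3) / (norm c + d / 3)"
  define l2 where "l2 = (norm c - d / 3) / (norm c - 2 * d / 3)"
  define l where "l = (if c = 0 then l1 else min l1 l2)"
  have nc: "norm c \<ge> 0" by simp
  have pos: "norm c + d / 3 > 0" using d(1) nc by linarith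
  have l1: "l1 > 1" using d pos by (simp add: l1_def field_simps)
  have pos2: "norm c - 2 * d / 3 > 0" if "c \<noteq> 0" using d(1) d(3)[OF that] by linarith
  have l2: "l2 > 1" if "c \<noteq> 0" using d pos2[OF that] by (simp add: l2_def field_simps)
  have l: "l > 1" using l1 l2 by (auto simp: l_def)
  \<comment> \<open>The origin is removed in the last case because a negative \<open>powi\<close> of
    0 is 0. For \<open>c = 0\<close> negative exponents are excluded, so any nonempty choice of
    \<open>V False\<close> will do.\<close>
  define V where "V s = (if s then A \<inter> {\<zeta>. norm c + 2 * d / 3 < norm \<zeta>}
      else if c = 0 then A else A \<inter> - {0} \<inter> {\<zeta>. norm \<zeta> < norm c - 2 * d / 3})" for s
  have opV: "open (V s)" for s
    unfolding V_def using assms(1) by (auto intro!: open_Int open_Collect_less continuous_intros)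
  have neV: "V s \<noteq> {}" for s
  proof (cases s)
    case True
    then have "zp \<in> V s" using zp d(1) by (simp add: V_def)
    then show ?thesis by blast
  next
    case False
    show ?thesis
    proof (cases "c = 0")
      case True
      then show ?thesis using False assms(2) by (auto simp: V_def)
    next
      case c: False
      have "norm zm > 0" "norm zm < norm c - 2 * d / 3"
        using zm(2)[OF c] d(1) d(3)[OF c] by linarith+
      then have "zm \<in> V s" using False c zm(1) by (auto simp: V_def)
      then show ?thesis by blast
    qed
  qed
  have subV: "V s \<subseteq> A" for s by (auto simp: V_def)
  have key: "l ^ nat \<bar>k\<bar> * norm z powi k \<le> norm \<zeta> powi k"
    if k: "0 \<le> k \<or> c \<noteq> 0" and z: "z \<in> ball c (d / 3)" and \<zeta>: "\<zeta> \<in> V (0 \<le> k)" for k z \<zeta>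
  proof (cases "0 \<le> k")
    case True
    have "norm z \<le> norm c + norm (z - c)" by (metis norm_triangle_sub)
    then have "norm z \<le> norm c + d / 3" using z by (simp add: dist_norm norm_minus_commute)
    then have "l * norm z \<le> l1 * (norm c + d / 3)"
      using l l1 by (intro mult_mono) (auto simp: l_def)
    also have "\<dots> = norm c + 2 * d / 3" using pos by (simp add: l1_def)
    also have "\<dots> \<le> norm \<zeta>" using \<zeta> True by (simp add: V_def)
    finally have "(l * norm z) ^ nat k \<le> norm \<zeta> ^ nat k"
      using l by (intro power_mono) auto
    then show ?thesis using True by (simp add: power_int_def power_mult_distrib)
  next
    case False
    then have c: "c \<noteq> 0" using k by simp
    have \<zeta>: "0 < norm \<zeta>" "norm \<zeta> < norm c - 2 * d / 3" using \<zeta> False c by (auto simp: V_def)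
    have "norm c \<le> norm z + norm (c - z)" by (metis norm_triangle_sub)
    then have z': "norm c - d / 3 \<le> norm z" using z by (simp add: dist_norm)
    have "l * norm \<zeta> \<le> l2 * (norm c - 2 * d / 3)"
      using l \<zeta> l2[OF c] c by (intro mult_mono) (auto simp: l_def)
    also have "\<dots> = norm c - d / 3" using pos2[OF c] by (simp add: l2_def)
    finally have le: "l * norm \<zeta> \<le> norm z" using z' by linarith
    then have "(l * norm \<zeta>) ^ nat (- k) \<le> norm z ^ nat (- k)"
      using l by (intro power_mono) auto
    moreover have "0 < norm z" using le l \<zeta>(1) by (smt (verit) mult_pos_pos)
    ultimately show ?thesis
      using False \<zeta>(1) by (simp add: power_int_def power_mult_distrib field_simps)
  qed
  have "open (ball c (d / 3))" "c \<in> ball c (d / 3)" using d(1) by auto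
  then show ?thesis
    using l opV neV subV key
    by (intro exI[of _ l] exI[of _ "ball c (d / 3)"] exI[of _ V]) blast
qed

lemma Lp_norm_pow_nonneg: "0 \<le> Lp_norm_pow p \<Omega> f"
  by (simp add: Lp_norm_pow_def set_lebesgue_integral_def integral_nonneg)

lemma Lp_norm_pow_ge_ball:
  assumes int: "set_integrable lborel \<Omega> (\<lambda>z. norm (f z) powr p)"
    and sub: "ball b r \<subseteq> \<Omega>" and ge: "\<And>\<zeta>. \<zeta> \<in> ball b r \<Longrightarrow> m \<le> norm (f \<zeta>) powr p"
  shows "m * measure lborel (ball b r) \<le> Lp_norm_pow p \<Omega> f"
proof -
  have fin: "emeasure lborel (ball b r) \<noteq> \<infinity>"
    using emeasure_lborel_ball_finite[of b r] by simp
  have intB: "set_integrable lborel (ball b r) (\<lambda>z. norm (f z) powr p)"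
    by (rule set_integrable_subset[OF int _ sub]) auto
  have "m * measure lborel (ball b r) = (LINT z:ball b r|lborel. m)"
    using fin by (simp add: set_integral_const)
  also have "\<dots> \<le> (LINT z:ball b r|lborel. norm (f z) powr p)"
    using fin intB ge by (intro set_integral_mono) (auto simp: set_integrable_def less_top)
  also have "\<dots> \<le> (LINT z:\<Omega>|lborel. norm (f z) powr p)"
    using int intB sub unfolding set_lebesgue_integral_def set_integrable_def
    by (intro integral_mono) (auto simp: indicator_def)
  finally show ?thesis by (simp add: Lp_norm_pow_def)
qed

text \<open>Moving every coordinate according to the sign of its exponent gives a ball in \<^term>\<open>\<Omega>\<close> on which
  the monomial exceeds its values near \<^term>\<open>a\<close> by a factor exponential in the exponents. The ball
  depends only on the \<^emph>\<open>signs\<close>, hence on finitely many choices, so its volume is bounded below.\<close>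

lemma laurent_monomial_bound_near:
  fixes \<Omega> :: "(complex ^ 'n) set"
  assumes op: "open \<Omega>" and a: "a \<in> \<Omega>" and p: "p > 0"
  shows "\<exists>N g. open N \<and> a \<in> N \<and> g summable_on UNIV \<and> (\<forall>\<alpha>. 0 \<le> g \<alpha>) \<and>
    (\<forall>\<alpha>\<in>allowable p \<Omega>. \<forall>z\<in>N. norm (laurent_monomial \<alpha> z) powr p \<le> g \<alpha> * Lp_norm_pow p \<Omega> (laurent_monomial \<alpha>))"
proof -
  obtain A where A: "\<And>k. open (A k) \<and> a $ k \<in> A k" "\<And>y. (\<And>k. y $ k \<in> A k) \<Longrightarrow> y \<in> \<Omega>"
    using op a(1) unfolding open_vec_def by metis
  have "\<forall>i. \<exists>l U V. l > (1::real) \<and> open U \<and> a $ i \<in> U \<and> (\<forall>s. open (V s) \<and> V s \<noteq> {} \<and> V s \<subseteq> A i) \<and>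
    (\<forall>k z \<zeta>. (0 \<le> k \<or> a $ i \<noteq> 0) \<longrightarrow> z \<in> U \<longrightarrow> \<zeta> \<in> V (0 \<le> k) \<longrightarrow>
       l ^ nat \<bar>k\<bar> * norm z powi k \<le> norm \<zeta> powi k)"
    using A(1) by (intro allI laurent_power_gain) auto
  then obtain l U V where
      l: "\<And>i. l i > (1::real)" and U: "\<And>i. open (U i)" "\<And>i. a $ i \<in> U i"
      and V: "\<And>i s. open (V i s)" "\<And>i s. V i s \<noteq> {}" "\<And>i s. V i s \<subseteq> A i"
      and gain: "\<And>i k z \<zeta>. 0 \<le> k \<or> a $ i \<noteq> 0 \<Longrightarrow> z \<in> U i \<Longrightarrow> \<zeta> \<in> V i (0 \<le> k) \<Longrightarrow>
       l i ^ nat \<bar>k\<bar> * norm z powi k \<le> norm \<zeta> powi k"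
    by metis
  define N where "N = {z. \<forall>i. z $ i \<in> U i}"
  \<comment> \<open>Here \<open>s\<close> is a sign pattern: it records for each coordinate whether
    the exponent is nonnegative.\<close>
  define D where "D s = {z. \<forall>i. z $ i \<in> V i (s i)}" for s
  have opN: "open N" unfolding N_def using U by (simp add: Collect_all_eq open_INT open_vimage_vec_nth[unfolded vimage_def])
  have opD: "open (D s)" for s
    unfolding D_def using V by (simp add: Collect_all_eq open_INT open_vimage_vec_nth[unfolded vimage_def])
  have subD: "D s \<subseteq> \<Omega>" for s using V(3) by (auto simp: D_def intro!: A(2))
  have "\<exists>b r. r > 0 \<and> ball b r \<subseteq> D s" for s
  proof -
    have "(\<chi> i. SOME x. x \<in> V i (s i)) \<in> D s"
      using V(2) by (auto simp: D_def some_in_eq)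
    then show ?thesis using opD openE by metis
  qed
  then obtain b r where br: "\<And>s. r s > 0" "\<And>s. ball (b s) (r s) \<subseteq> D s" by metis
  define \<mu> where "\<mu> s = measure lborel (ball (b s) (r s))" for s
  have \<mu>: "\<mu> s > 0" for s using br(1) by (simp add: \<mu>_def content_ball_pos)
  \<comment> \<open>The gain per unit of exponent, raised to the power \<open>p\<close> and
    inverted, is the rate of decay of the majorant.\<close>
  define q where "q i = 1 / (l i powr p)" for i
  have lp: "l i powr p > 1" for i using l p by (simp add: gr_one_powr)
  have q: "0 < q i" "q i < 1" for i using lp[of i] by (auto simp: q_def divide_less_eq)
  define Q where "Q \<alpha> = (\<Prod>i\<in>UNIV. q i ^ nat \<bar>\<alpha> $ i\<bar>)" for \<alpha> :: "int ^ 'n"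
  have Q: "0 < Q \<alpha>" for \<alpha> using q by (auto simp: Q_def intro!: prod_pos)
  \<comment> \<open>There are finitely many sign patterns, so this sum dominates every
    \<open>1 / \<mu> s\<close> at once.\<close>
  define C where "C = (\<Sum>s\<in>UNIV. 1 / \<mu> s)"
  have C: "1 / \<mu> s \<le> C" for s
    unfolding C_def using \<mu> by (intro member_le_sum) (auto intro: less_imp_le)
  have C0: "0 \<le> C" unfolding C_def using \<mu> by (intro sum_nonneg) (auto intro: less_imp_le)
  have "Q summable_on UNIV"
    unfolding Q_def[abs_def] using q
    by (intro summable_on_prod_vec summable_on_power_abs) (auto intro: less_imp_le)
  then have g: "(\<lambda>\<alpha>. C * Q \<alpha>) summable_on UNIV" by (rule summable_on_cmult_right)
  have bound: "norm (laurent_monomial \<alpha> z) powr p \<le> (C * Q \<alpha>) * Lp_norm_pow p \<Omega> (laurent_monomial \<alpha>)"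
    if al: "\<alpha> \<in> allowable p \<Omega>" and z: "z \<in> N" for \<alpha> z
  proof -
    define s where "s i = (0 \<le> \<alpha> $ i)" for i
    define L where "L = (\<Prod>i\<in>UNIV. l i ^ nat \<bar>\<alpha> $ i\<bar>)"
    have l0: "0 < l i" for i using l[of i] by linarith
    have L0: "0 \<le> L" unfolding L_def using l0 by (intro prod_nonneg) (simp add: less_imp_le)
    have pow: "(l i ^ n) powr p = (l i powr p) ^ n" for i n
      using l0[of i] by (simp add: powr_realpow[symmetric] powr_powr mult.commute)
    have "(\<Prod>i\<in>UNIV. l i ^ nat \<bar>\<alpha> $ i\<bar>) powr p = (\<Prod>i\<in>UNIV. (l i ^ nat \<bar>\<alpha> $ i\<bar>) powr p)"
      by (rule prod_powr_distrib)
    also have "\<dots> = (\<Prod>i\<in>UNIV. (l i powr p) ^ nat \<bar>\<alpha> $ i\<bar>)"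
      by (simp only: pow)
    also have "\<dots> = 1 / Q \<alpha>" by (simp add: Q_def q_def power_one_over prod_dividef)
    finally have L: "L powr p = 1 / Q \<alpha>" unfolding L_def .
    have int: "set_integrable lborel \<Omega> (\<lambda>z. norm (laurent_monomial \<alpha> z) powr p)"
      using al by (simp add: allowable_def bergman_space_def)
    have ge: "norm (laurent_monomial \<alpha> z) powr p / Q \<alpha> \<le> norm (laurent_monomial \<alpha> \<zeta>) powr p"
      if "\<zeta> \<in> ball (b s) (r s)" for \<zeta>
    proof -
      have \<zeta>: "\<zeta> $ i \<in> V i (0 \<le> \<alpha> $ i)" for i using that br(2)[of s] by (auto simp: D_def s_def)
      have zi: "z $ i \<in> U i" for i using z by (simp add: N_def)
      \<comment> \<open>This is the side condition of \<open>gain\<close>: a negative exponent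
        occurs only where \<open>a\<close> has a nonzero coordinate.\<close>
      have sgn: "0 \<le> \<alpha> $ i \<or> a $ i \<noteq> 0" for i
        using allowable_exponent_nonneg[OF op al a] by blast
      have "L * norm (laurent_monomial \<alpha> z)
          = (\<Prod>i\<in>UNIV. l i ^ nat \<bar>\<alpha> $ i\<bar> * norm (z $ i) powi (\<alpha> $ i))"
        by (simp add: L_def norm_laurent_monomial prod.distrib)
      also have "\<dots> \<le> norm (laurent_monomial \<alpha> \<zeta>)"
        unfolding norm_laurent_monomial using gain[OF sgn zi \<zeta>] l0
        by (intro prod_mono) (auto intro!: mult_nonneg_nonneg zero_le_power less_imp_le[OF l0])
      finally have "(L * norm (laurent_monomial \<alpha> z)) powr p \<le> norm (laurent_monomial \<alpha> \<zeta>) powr p"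
        using p L0 by (intro powr_mono2) auto
      moreover have "(L * norm (laurent_monomial \<alpha> z)) powr p = L powr p * norm (laurent_monomial \<alpha> z) powr p"
        by (rule powr_mult)
      ultimately show ?thesis by (simp add: L)
    qed
    have "norm (laurent_monomial \<alpha> z) powr p / Q \<alpha> * \<mu> s \<le> Lp_norm_pow p \<Omega> (laurent_monomial \<alpha>)"
      unfolding \<mu>_def using int ge br(2)[of s] subD by (intro Lp_norm_pow_ge_ball) auto
    then have "norm (laurent_monomial \<alpha> z) powr p \<le> (1 / \<mu> s) * Q \<alpha> * Lp_norm_pow p \<Omega> (laurent_monomial \<alpha>)"
      using \<mu>[of s] Q[of \<alpha>] by (simp add: field_simps)
    also have "\<dots> \<le> (C * Q \<alpha>) * Lp_norm_pow p \<Omega> (laurent_monomial \<alpha>)"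
      using C[of s] Q[of \<alpha>]
      by (intro mult_right_mono) (auto simp: Lp_norm_pow_nonneg)
    finally show ?thesis .
  qed
  have "a \<in> N" using U by (simp add: N_def)
  moreover have "0 \<le> C * Q \<alpha>" for \<alpha> using C0 Q[of \<alpha>] by simp
  ultimately show ?thesis
    using opN g bound by (intro exI[of _ N] exI[of _ "\<lambda>\<alpha>. C * Q \<alpha>"]) auto
qed

text \<open>Finitely many of the local neighbourhoods cover \<open>L\<close>, and the sum of their
  nonnegative majorants serves for all of them.\<close>

lemma laurent_monomial_bound_compact:
  fixes \<Omega> :: "(complex ^ 'n) set"
  assumes op: "open \<Omega>" and L: "compact L" "L \<subseteq> \<Omega>" and p: "p > 0"
  shows "\<exists>g. g summable_on UNIV \<and> (\<forall>\<alpha>. 0 \<le> g \<alpha>) \<and>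
    (\<forall>\<alpha>\<in>allowable p \<Omega>. \<forall>z\<in>L. norm (laurent_monomial \<alpha> z) powr p \<le> g \<alpha> * Lp_norm_pow p \<Omega> (laurent_monomial \<alpha>))"
proof -
  have "\<forall>a\<in>L. \<exists>N g. open N \<and> a \<in> N \<and> g summable_on UNIV \<and> (\<forall>\<alpha>. 0 \<le> g \<alpha>) \<and>
    (\<forall>\<alpha>\<in>allowable p \<Omega>. \<forall>z\<in>N. norm (laurent_monomial \<alpha> z) powr p \<le> g \<alpha> * Lp_norm_pow p \<Omega> (laurent_monomial \<alpha>))"
    using L(2) by (intro ballI laurent_monomial_bound_near op p) auto
  from bchoice[OF this] obtain N where "\<forall>a\<in>L. \<exists>g. open (N a) \<and> a \<in> N a \<and> g summable_on UNIV \<and> (\<forall>\<alpha>. 0 \<le> g \<alpha>) \<and>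
    (\<forall>\<alpha>\<in>allowable p \<Omega>. \<forall>z\<in>N a. norm (laurent_monomial \<alpha> z) powr p \<le> g \<alpha> * Lp_norm_pow p \<Omega> (laurent_monomial \<alpha>))"
    by blast
  from bchoice[OF this] obtain g where Ng: "\<And>a. a \<in> L \<Longrightarrow> open (N a)" "\<And>a. a \<in> L \<Longrightarrow> a \<in> N a"
      "\<And>a. a \<in> L \<Longrightarrow> g a summable_on UNIV" "\<And>a \<alpha>. a \<in> L \<Longrightarrow> 0 \<le> g a \<alpha>"
    and b: "\<And>a \<alpha> z. a \<in> L \<Longrightarrow> \<alpha> \<in> allowable p \<Omega> \<Longrightarrow> z \<in> N a \<Longrightarrow>
      norm (laurent_monomial \<alpha> z) powr p \<le> g a \<alpha> * Lp_norm_pow p \<Omega> (laurent_monomial \<alpha>)"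
    by blast
  obtain T where T: "T \<subseteq> L" "finite T" "L \<subseteq> (\<Union>a\<in>T. N a)"
    using Ng(1,2) by (elim compactE_image[OF L(1)]) auto
  have "norm (laurent_monomial \<alpha> z) powr p \<le> (\<Sum>a\<in>T. g a \<alpha>) * Lp_norm_pow p \<Omega> (laurent_monomial \<alpha>)"
    if "\<alpha> \<in> allowable p \<Omega>" "z \<in> L" for \<alpha> z
  proof -
    obtain a where a: "a \<in> T" "z \<in> N a" using T(3) \<open>z \<in> L\<close> by auto
    have "norm (laurent_monomial \<alpha> z) powr p \<le> g a \<alpha> * Lp_norm_pow p \<Omega> (laurent_monomial \<alpha>)"
      using a T(1) \<open>\<alpha> \<in> allowable p \<Omega>\<close> b by auto
    also have "\<dots> \<le> (\<Sum>a\<in>T. g a \<alpha>) * Lp_norm_pow p \<Omega> (laurent_monomial \<alpha>)"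
      using a(1) T(1,2) Ng(4)
      by (intro mult_right_mono member_le_sum) (auto simp: Lp_norm_pow_nonneg)
    finally show ?thesis .
  qed
  moreover have "(\<lambda>\<alpha>. \<Sum>a\<in>T. g a \<alpha>) summable_on UNIV"
    using T(2,1) by (induction T rule: finite_induct) (auto intro!: summable_on_add Ng(3))
  moreover have "0 \<le> (\<Sum>a\<in>T. g a \<alpha>)" for \<alpha> using Ng(4) T(1) by (intro sum_nonneg) auto
  ultimately show ?thesis by (intro exI[of _ "\<lambda>\<alpha>. \<Sum>a\<in>T. g a \<alpha>"]) auto
qed

section \<open>Norms of monomials along the exhaustion\<close>

lemma filterlim_at_top_incseq:
  fixes X :: "nat \<Rightarrow> real"
  assumes "incseq X" "\<not> convergent X"
  shows "filterlim X at_top sequentially"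
  unfolding filterlim_at_top
proof
  fix Z
  have "\<not> (\<forall>i. X i \<le> Z)"
    using incseq_convergent[OF assms(1)] assms(2) by (metis convergentI)
  then obtain N where "Z < X N" by (auto simp: not_le)
  then have "Z \<le> X n" if "n \<ge> N" for n
    using incseqD[OF assms(1) that] by linarith
  then show "\<forall>\<^sub>F n in sequentially. Z \<le> X n"
    unfolding eventually_sequentially by blast
qed

lemma allowable_antimono:
  assumes "A \<subseteq> B" "open A" "\<alpha> \<in> allowable p B"
  shows "\<alpha> \<in> allowable p A"
  using assms by (auto simp: allowable_def bergman_space_def holomorphic_cn_def intro: set_integrable_subset)

text \<open>Allowability on the larger set is essential: the integral of a non-integrable function
  is 0, which would reverse the comparison.\<close>

lemma Lp_norm_pow_mono:
  assumes "A \<subseteq> B" "open A" "\<alpha> \<in> allowable p B"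
  shows "Lp_norm_pow p A (laurent_monomial \<alpha>) \<le> Lp_norm_pow p B (laurent_monomial \<alpha>)"
proof -
  have "set_integrable lborel A (\<lambda>z. norm (laurent_monomial \<alpha> z) powr p)"
    and "set_integrable lborel B (\<lambda>z. norm (laurent_monomial \<alpha> z) powr p)"
    using assms(3) allowable_antimono[OF assms] by (auto simp: allowable_def bergman_space_def)
  then show ?thesis
    using assms(1) unfolding Lp_norm_pow_def set_lebesgue_integral_def set_integrable_def
    by (intro integral_mono) (auto simp: indicator_def)
qed

text \<open>The value 0 outside the allowable set is the limit of \<open>1 / \<parallel>e\<^sub>\<alpha>\<parallel>\<^sup>p\<close> when the norms blow up along
  the exhaustion.\<close>

definition inverse_norm_pow :: "real \<Rightarrow> (complex ^ 'n) set \<Rightarrow> int ^ 'n \<Rightarrow> real" where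
  "inverse_norm_pow p \<Omega> \<alpha> =
     (if \<alpha> \<in> allowable p \<Omega> then 1 / Lp_norm_pow p \<Omega> (laurent_monomial \<alpha>) else 0)"

text \<open>Three cases: if \<open>\<alpha>\<close> is allowable on the union, the integrals
  converge; if it fails on some \<open>A j0\<close>, it fails on all later sets and on the union; if
  it fails only on the union, the norms tend to infinity.\<close>

lemma tendsto_inverse_norm_pow:
  fixes A :: "nat \<Rightarrow> (complex ^ 'n) set"
  assumes op: "\<And>j. open (A j)" and inc: "incseq A"
  shows "(\<lambda>j. inverse_norm_pow p (A j) \<alpha>) \<longlonglongrightarrow> inverse_norm_pow p (\<Union>j. A j) \<alpha>"
proof -
  define U where "U = (\<Union>j. A j)"
  define f where "f z = norm (laurent_monomial \<alpha> z) powr p" for z :: "complex ^ 'n"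
  have AU: "A j \<subseteq> U" for j by (auto simp: U_def)
  have mono: "A i \<subseteq> A j" if "i \<le> j" for i j using inc that by (simp add: incseq_def)
  have opU: "open U" using op by (auto simp: U_def)
  consider (bdd) "\<alpha> \<in> allowable p U" | (out) j0 where "\<alpha> \<notin> allowable p (A j0)"
    | (unbdd) "\<alpha> \<notin> allowable p U" "\<And>j. \<alpha> \<in> allowable p (A j)" by blast
  then have "(\<lambda>j. inverse_norm_pow p (A j) \<alpha>) \<longlonglongrightarrow> inverse_norm_pow p U \<alpha>"
  proof cases
    case bdd
    then have al: "\<alpha> \<in> allowable p (A j)" for j
      using allowable_antimono[OF AU op] by blast
    have lim: "(\<lambda>j. Lp_norm_pow p (A j) (laurent_monomial \<alpha>)) \<longlonglongrightarrow> Lp_norm_pow p U (laurent_monomial \<alpha>)"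
      unfolding Lp_norm_pow_def U_def using bdd op inc
      by (intro set_integral_cont_up) (auto simp: allowable_def bergman_space_def U_def)
    \<comment> \<open>A vanishing limit forces all the norms to vanish, and \<open>1 / 0 = 0\<close>
      then makes both sides 0.\<close>
    show ?thesis
    proof (cases "Lp_norm_pow p U (laurent_monomial \<alpha>) = 0")
      case True
      then have "Lp_norm_pow p (A j) (laurent_monomial \<alpha>) = 0" for j
        using Lp_norm_pow_mono[OF AU op bdd, of j] Lp_norm_pow_nonneg[of p "A j" "laurent_monomial \<alpha>"] by linarith
      with True show ?thesis by (simp add: inverse_norm_pow_def if_distrib cong: if_cong)
    next
      case False
      then show ?thesis using lim al bdd
        by (auto simp: inverse_norm_pow_def intro!: tendsto_divide)
    qed
  next
    case out
    have "\<alpha> \<notin> allowable p (A j)" if "j \<ge> j0" for j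
      using allowable_antimono[OF mono[OF that] op] out by blast
    moreover have "\<alpha> \<notin> allowable p U"
      using allowable_antimono[OF AU op] out by blast
    ultimately have "\<forall>\<^sub>F j in sequentially. inverse_norm_pow p (A j) \<alpha> = inverse_norm_pow p U \<alpha>"
      unfolding eventually_sequentially by (auto simp: inverse_norm_pow_def intro!: exI[of _ j0])
    then show ?thesis by (rule tendsto_eventually)
  next
    case unbdd
    have int: "set_integrable lborel (A j) f" for j
      using unbdd(2) unfolding f_def by (simp add: allowable_def bergman_space_def)
    \<comment> \<open>Holomorphy is local and so passes to the union; only integrability can fail
      there, and bounded norms would restore it by monotone convergence.\<close>
    have hol: "holomorphic_cn (laurent_monomial \<alpha>) U"
      using unbdd(2) unfolding U_def by (auto simp: allowable_def bergman_space_def holomorphic_cn_def)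
    have "incseq (\<lambda>j. Lp_norm_pow p (A j) (laurent_monomial \<alpha>))"
      using Lp_norm_pow_mono[OF mono op unbdd(2)] by (simp add: incseq_def)
    moreover have "\<not> convergent (\<lambda>j. Lp_norm_pow p (A j) (laurent_monomial \<alpha>))"
    proof
      assume "convergent (\<lambda>j. Lp_norm_pow p (A j) (laurent_monomial \<alpha>))"
      then obtain x where x: "(\<lambda>j. Lp_norm_pow p (A j) (laurent_monomial \<alpha>)) \<longlonglongrightarrow> x"
        by (auto simp: convergent_def)
      have ptw: "(\<lambda>j. indicator (A j) z *\<^sub>R f z) \<longlonglongrightarrow> indicator U z *\<^sub>R f z" for z
        unfolding U_def by (intro tendsto_intros LIMSEQ_indicator_incseq inc)
      have "integrable lborel (\<lambda>z. indicator U z *\<^sub>R f z)"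
      proof (rule integrable_monotone_convergence)
        show "integrable lborel (\<lambda>z. indicator (A j) z *\<^sub>R f z)" for j
          using int by (simp add: set_integrable_def)
        show "AE z in lborel. mono (\<lambda>j. indicator (A j) z *\<^sub>R f z)"
          using mono by (intro AE_I2) (force simp: mono_def indicator_def f_def)
        show "AE z in lborel. (\<lambda>j. indicator (A j) z *\<^sub>R f z) \<longlonglongrightarrow> indicator U z *\<^sub>R f z"
          using ptw by simp
        show "(\<lambda>j. LINT z|lborel. indicator (A j) z *\<^sub>R f z) \<longlonglongrightarrow> x"
          using x unfolding Lp_norm_pow_def set_lebesgue_integral_def f_def .
        \<comment> \<open>Measurability on the union is inherited from the pieces through the
          pointwise limit.\<close>
        show "(\<lambda>z. indicator U z *\<^sub>R f z) \<in> borel_measurable lborel"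
        proof (rule borel_measurable_LIMSEQ_metric)
          show "(\<lambda>z. indicator (A j) z *\<^sub>R f z) \<in> borel_measurable lborel" for j
            using int[of j] unfolding set_integrable_def by (rule borel_measurable_integrable)
        qed (rule ptw)
      qed
      with hol have "\<alpha> \<in> allowable p U"
        by (simp add: allowable_def bergman_space_def set_integrable_def f_def)
      with unbdd(1) show False by contradiction
    qed
    ultimately have "filterlim (\<lambda>j. Lp_norm_pow p (A j) (laurent_monomial \<alpha>)) at_top sequentially"
      by (rule filterlim_at_top_incseq)
    then have "(\<lambda>j. 1 / Lp_norm_pow p (A j) (laurent_monomial \<alpha>)) \<longlonglongrightarrow> 0"
      by (intro tendsto_divide_0[OF tendsto_const]) (rule filterlim_at_top_imp_at_infinity)
    with unbdd show ?thesis by (simp add: inverse_norm_pow_def)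
  qed
  then show ?thesis by (simp add: U_def)
qed

section \<open>Uniform convergence of the kernels\<close>

text \<open>This is the factor of \<open>monomial_term\<close> that is independent of the domain, so
  the dependence on \<open>j\<close> sits in a scalar coefficient.\<close>

definition monomial_weight :: "real \<Rightarrow> int ^ 'n \<Rightarrow> complex ^ 'n \<Rightarrow> complex ^ 'n \<Rightarrow> complex" where
  "monomial_weight p \<alpha> z w = laurent_monomial \<alpha> z * cnj (laurent_monomial \<alpha> w)
     * of_real (norm (laurent_monomial \<alpha> w) powr (p - 2))"

lemma monomial_term_eq:
  "monomial_term p \<Omega> \<alpha> z w = of_real (inverse_norm_pow p \<Omega> \<alpha>) * monomial_weight p \<alpha> z w"
  by (simp add: monomial_term_def inverse_norm_pow_def monomial_weight_def)

lemma norm_monomial_weight_le: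
  assumes p: "p \<ge> 1" and B: "0 \<le> B" "norm (laurent_monomial \<alpha> z) powr p \<le> B" "norm (laurent_monomial \<alpha> w) powr p \<le> B"
  shows "norm (monomial_weight p \<alpha> z w) \<le> B"
proof -
  define m where "m = max (norm (laurent_monomial \<alpha> z)) (norm (laurent_monomial \<alpha> w))"
  \<comment> \<open>The powers combine also when the monomial vanishes at \<open>w\<close>, since 0
    \<open>powr\<close> anything is 0, even for \<open>p = 1\<close>.\<close>
  have eq: "norm (monomial_weight p \<alpha> z w) =
      norm (laurent_monomial \<alpha> z) * norm (laurent_monomial \<alpha> w) powr (p - 1)"
    using powr_add[of "norm (laurent_monomial \<alpha> w)" 1 "p - 2"]
    by (simp add: monomial_weight_def norm_mult mult.assoc)
  also have "\<dots> \<le> m * m powr (p - 1)"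
    using p by (intro mult_mono powr_mono2) (auto simp: m_def le_max_iff_disj)
  also have "\<dots> = m powr p"
    using powr_add[of m 1 "p - 1"] by (simp add: m_def le_max_iff_disj)
  also have "\<dots> \<le> B" using B by (simp add: m_def max_def)
  finally show ?thesis .
qed

text \<open>The majorant is built once, on a set \<open>A J\<close> containing both projections of
  \<open>K\<close>. Passing to larger \<open>A j\<close> only increases the norms in the
  denominators, so it bounds the terms for all \<open>j \<ge> J\<close>.\<close>

lemma uniform_limit_monomial_basis_kernel:
  fixes A :: "nat \<Rightarrow> (complex ^ 'n) set"
  assumes op: "\<And>j. open (A j)" and inc: "incseq A" and p: "p \<ge> 1"
    and K: "compact K" and ev: "\<forall>\<^sub>F j in sequentially. K \<subseteq> A j \<times> A j"
  shows "uniform_limit K (\<lambda>j (z, w). monomial_basis_kernel p (A j) z w)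
    (\<lambda>(z, w). monomial_basis_kernel p (\<Union>j. A j) z w) sequentially"
proof -
  obtain J where J: "K \<subseteq> A J \<times> A J"
    using ev unfolding eventually_sequentially by blast
  define L where "L = fst ` K \<union> snd ` K"
  have L: "compact L" "L \<subseteq> A J"
    using K J unfolding L_def by (auto intro!: compact_continuous_image continuous_intros)
  define Nm where "Nm \<alpha> = Lp_norm_pow p (A J) (laurent_monomial \<alpha>)" for \<alpha> :: "int ^ 'n"
  obtain g where g: "g summable_on UNIV" "\<And>\<alpha>. 0 \<le> g \<alpha>"
    and b: "\<And>\<alpha> z. \<alpha> \<in> allowable p (A J) \<Longrightarrow> z \<in> L \<Longrightarrow> norm (laurent_monomial \<alpha> z) powr p \<le> g \<alpha> * Nm \<alpha>"
    using laurent_monomial_bound_compact[OF op[of J] L, of p] p unfolding Nm_def by auto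
  have Nm0: "0 \<le> Nm \<alpha>" for \<alpha> by (simp add: Nm_def Lp_norm_pow_nonneg)
  have weight: "norm (monomial_weight p \<alpha> (fst x) (snd x)) \<le> g \<alpha> * Nm \<alpha>"
    if "\<alpha> \<in> allowable p (A J)" "x \<in> K" for \<alpha> x
    using that g(2) Nm0 by (intro norm_monomial_weight_le p b mult_nonneg_nonneg) (auto simp: L_def)
  have mono: "A J \<subseteq> A j" if "J \<le> j" for j using inc that by (simp add: incseq_def)
  have bound: "norm (monomial_term p (A j) \<alpha> (fst x) (snd x)) \<le> g \<alpha>" if "J \<le> j" "x \<in> K" for j \<alpha> x
  proof (cases "\<alpha> \<in> allowable p (A j)")
    case True
    define M where "M = Lp_norm_pow p (A j) (laurent_monomial \<alpha>)"
    have alJ: "\<alpha> \<in> allowable p (A J)" using allowable_antimono[OF mono[OF that(1)] op True] .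
    have "Nm \<alpha> \<le> M" unfolding Nm_def M_def using Lp_norm_pow_mono[OF mono[OF that(1)] op True] .
    then have "norm (monomial_weight p \<alpha> (fst x) (snd x)) \<le> g \<alpha> * M"
      using weight[OF alJ that(2)] mult_left_mono[of "Nm \<alpha>" M "g \<alpha>"] g(2) by (meson order_trans)
    moreover have "0 \<le> M" by (simp add: M_def Lp_norm_pow_nonneg)
    moreover have "norm (monomial_term p (A j) \<alpha> (fst x) (snd x)) = norm (monomial_weight p \<alpha> (fst x) (snd x)) / M"
      using True \<open>0 \<le> M\<close> by (simp add: monomial_term_eq inverse_norm_pow_def norm_mult norm_divide M_def)
    \<comment> \<open>If \<open>M = 0\<close>, division by 0 makes the term 0.\<close>
    ultimately show ?thesis using g(2) by (cases "M = 0") (simp_all add: divide_le_eq)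
  next
    case False
    then show ?thesis using g(2) by (simp add: monomial_term_def)
  qed
  have lim: "uniform_limit K (\<lambda>j x. monomial_term p (A j) \<alpha> (fst x) (snd x))
      (\<lambda>x. monomial_term p (\<Union>j. A j) \<alpha> (fst x) (snd x)) sequentially" for \<alpha>
  proof (cases "\<alpha> \<in> allowable p (A J)")
    case True
    \<comment> \<open>The coefficient is constant in \<open>x\<close>, so its convergence is uniform
      on \<open>K\<close>; the weight is bounded on \<open>K\<close>, which carries this over to the
      product.\<close>
    have "uniform_limit K (\<lambda>j x. complex_of_real (inverse_norm_pow p (A j) \<alpha>))
        (\<lambda>x. of_real (inverse_norm_pow p (\<Union>j. A j) \<alpha>)) sequentially"
      using tendsto_of_real[OF tendsto_inverse_norm_pow[OF op inc]]
      by (auto simp: uniform_limit_iff simp del: dist_of_real dest!: tendstoD elim: eventually_mono)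
    moreover have "bounded ((\<lambda>x. monomial_weight p \<alpha> (fst x) (snd x)) ` K)"
      using weight[OF True] unfolding bounded_iff by blast
    moreover have "bounded ((\<lambda>x. complex_of_real (inverse_norm_pow p (\<Union>j. A j) \<alpha>)) ` K)"
      by (rule boundedI) auto
    ultimately show ?thesis
      unfolding monomial_term_eq by (intro uniform_lim_mult uniform_limit_const)
  next
    case False
    then have "\<alpha> \<notin> allowable p (A j)" if "J \<le> j" for j
      using allowable_antimono[OF mono[OF that] op] by blast
    moreover have "\<alpha> \<notin> allowable p (\<Union>j. A j)"
      using allowable_antimono[of "A J" "\<Union>j. A j", OF _ op] False by blast
    ultimately show ?thesis
      unfolding uniform_limit_iff eventually_sequentially
      by (auto simp: monomial_term_def intro!: exI[of _ J])
  qed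
  have "uniform_limit K (\<lambda>j x. \<Sum>\<^sub>\<infinity>\<alpha>. monomial_term p (A j) \<alpha> (fst x) (snd x))
      (\<lambda>x. \<Sum>\<^sub>\<infinity>\<alpha>. monomial_term p (\<Union>j. A j) \<alpha> (fst x) (snd x)) sequentially"
    using bound by (intro uniform_limit_infsum_dominated[OF lim _ g(1)]) (unfold eventually_sequentially, blast)
  then show ?thesis
    by (simp add: monomial_basis_kernel_def case_prod_beta')
qed

theorem theorem5p5:
  fixes \<Omega> :: "nat \<Rightarrow> (complex ^ 'n) set"
  assumes "\<And>j. reinhardt_domain (\<Omega> j)"
    and "\<And>j. pseudoconvex (\<Omega> j)"
    and "\<And>j. \<Omega> j \<subseteq> \<Omega> (Suc j)"
  shows "reinhardt_domain (\<Union>j. \<Omega> j) \<and> pseudoconvex (\<Union>j. \<Omega> j) \<and>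
    (\<forall>K. compact K \<and> K \<subseteq> (\<Union>j. \<Omega> j) \<times> (\<Union>j. \<Omega> j) \<longrightarrow>
       (\<forall>\<^sub>F j in sequentially. K \<subseteq> \<Omega> j \<times> \<Omega> j) \<and>
       (\<forall>p\<ge>1. uniform_limit K
          (\<lambda>j (z, w). monomial_basis_kernel p (\<Omega> j) z w)
          (\<lambda>(z, w). monomial_basis_kernel p (\<Union>j. \<Omega> j) z w) sequentially))"
proof -
  have inc: "incseq \<Omega>" using assms(3) by (rule incseq_SucI)
  have op: "open (\<Omega> j)" for j using assms(1) by (simp add: reinhardt_domain_def)
  have ev: "\<forall>\<^sub>F j in sequentially. K \<subseteq> \<Omega> j \<times> \<Omega> j"
    if "compact K" "K \<subseteq> (\<Union>j. \<Omega> j) \<times> (\<Union>j. \<Omega> j)" for K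
  proof -
    \<comment> \<open>Once both projections of \<open>K\<close> lie in \<open>\<Omega> j\<close>, so
      does \<open>K\<close> in the square of \<open>\<Omega> j\<close>.\<close>
    have "compact (fst ` K \<union> snd ` K)"
      using that(1) by (intro compact_Un compact_continuous_image continuous_intros)
    then have "\<forall>\<^sub>F j in sequentially. fst ` K \<union> snd ` K \<subseteq> \<Omega> j"
      using that(2) by (intro compact_subset_incseq_open op inc) fastforce+
    then show ?thesis
      by eventually_elim (auto simp: mem_Times_iff)
  qed
  show ?thesis
    using reinhardt_domain_incseq_Union[OF assms(1) inc] pseudoconvex_incseq_Union[OF assms(2) inc]
      ev uniform_limit_monomial_basis_kernel[OF op inc] by blast
qed

end
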